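(* Let $1<p<\infty$, let $n\in\mathbb N$ and let $T\in\mathcal L(\ell_p^n)$. Then $$\operatorname{conv}\bigl\{\langle Te_j,J(e_j)\rangle:\ j=1,\dots,n\bigr\}\subset W(T).$$
   Context: $\ell_p^n$ is $\mathbb C^n$ with the $\|\cdot\|_p$-norm, $e_1,\dots,e_n$ is its standard basis, and $\mathcal L(\ell_p^n)$ is the algebra of linear operators on it. $\operatorname{conv}$ denotes the convex hull. With $1/p+1/q=1$, the dual of $\ell_p^n$ is identified with $\ell_q^n$ via $\langle x,y\rangle=\sum_{j=1}^n x_j\overline{y_j}$. For $x=(x_j)\in\ell_p^n$ put $J(x)=(x_j|x_j|^{p-2})_j$ (with $0$ in the coordinates where $x_j=0$). The numerical range is $W(T)=\{\langle Tx,J(x)\rangle:\ x\in\ell_p^n,\ \|x\|_p=1\}$. *)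

theory Defs
  imports "HOL-Analysis.Analysis"
begin

text \<open>The space \<open>\<ell>\<^sub>p\<^sup>n\<close> is the type \<open>complex ^ 'n\<close> with \<open>n = CARD('n)\<close>; the library norm on this type
  is the Euclidean one, so the \<open>p\<close>-norm is a separate function of \<open>p\<close>.\<close>

definition lp_norm :: "real \<Rightarrow> complex ^ 'n \<Rightarrow> real" where
  "lp_norm p x = (\<Sum>j\<in>UNIV. cmod (x $ j) powr p) powr (1 / p)"

definition pairing :: "complex ^ 'n \<Rightarrow> complex ^ 'n \<Rightarrow> complex" where
  "pairing x y = (\<Sum>j\<in>UNIV. x $ j * cnj (y $ j))"

definition duality_map :: "real \<Rightarrow> complex ^ 'n \<Rightarrow> complex ^ 'n" where
  "duality_map p x =
     (\<chi> j. if x $ j = 0 then 0 else x $ j * of_real (cmod (x $ j) powr (p - 2)))"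

definition numerical_range :: "real \<Rightarrow> (complex ^ 'n \<Rightarrow> complex ^ 'n) \<Rightarrow> complex set" where
  "numerical_range p T = {pairing (T x) (duality_map p x) | x. lp_norm p x = 1}"

end

theory Submission
  imports Defs "HOL-Complex_Analysis.Winding_Numbers"
begin

text \<open>
Write \<open>g x = \<langle>T x, J x\<rangle> / (\<Sum>j. \<bar>x j\<bar>\<^sup>p)\<close>. This quotient is continuous on the nonzero vectors,
takes the value \<open>\<langle>T e\<^sub>j, J e\<^sub>j\<rangle>\<close> at every nonzero multiple of \<open>e\<^sub>j\<close>, and has all its values in
the numerical range, since numerator and denominator both scale with \<open>r\<^sup>p\<close> under \<open>x \<mapsto> r x\<close>,
\<open>r > 0\<close>. So it suffices to show that \<open>g\<close> takes every value in the convex hull of its values at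
the \<open>e\<^sub>j\<close>.

The numerical range need not be convex, and the point must be found by a topological argument.
The key step (\<open>axis_edge_path\<close>) joins \<open>e\<^sub>j\<close> to \<open>e\<^sub>k\<close> by a path of nonzero vectors along which \<open>g\<close>
stays on the straight line through \<open>g e\<^sub>j\<close> and \<open>g e\<^sub>k\<close>: along
\<open>(1 - s) e\<^sub>j + s w(s) e\<^sub>k\<close> with \<open>\<bar>w(s)\<bar> = 1\<close>, the two off-diagonal terms push \<open>g\<close> off the segment by
an \<open>\<real>\<close>-linear function of \<open>w(s)\<close>, and for a fixed \<open>s\<close> some phase \<open>w(s)\<close> makes the component of
this displacement normal to the line vanish. That the phase can be chosen continuously in \<open>s\<close>
(\<open>exists_phase\<close>) is the one delicate point.

By Caratheodory's theorem a point \<open>z\<close> of the hull lies in the triangle spanned by three of the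
values, hence on an edge or in the interior. On an edge, the intermediate value theorem applies to
the path above (\<open>segment_covered_by_path_on_line\<close>). In the interior, the three indices are
distinct, so \<open>n \<ge> 3\<close> and the nonzero vectors of \<open>\<complex>\<^sup>n\<close> form a simply connected set. The three edge
paths form a loop there, which contracts; if \<open>g\<close> omitted \<open>z\<close>, the image of the loop would have
winding number \<open>0\<close> about \<open>z\<close>. But each side of the image can be straightened along its own line,
which misses \<open>z\<close>, so that the winding number is that of the triangle, \<open>1\<close> or \<open>-1\<close>
(\<open>triangle_covered_by_simply_connected_image\<close>).
\<close>

section \<open>Covering a planar triangle by a continuous image\<close>

text \<open>The real line through \<open>a\<close> and \<open>b\<close>, as the vanishing of an \<open>\<real>\<close>-linear functional so that it can be
tested on sums; for \<open>a = b\<close> it is the whole plane.\<close>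
definition on_line :: "complex \<Rightarrow> complex \<Rightarrow> complex \<Rightarrow> bool" where
  "on_line a b z \<longleftrightarrow> Im ((z - a) * cnj (b - a)) = 0"

lemma convex_on_line: "convex {z. on_line a b z}"
proof (rule convexI)
  fix x y :: complex and u v :: real
  assume "x \<in> {z. on_line a b z}" "y \<in> {z. on_line a b z}" and uv: "u + v = 1"
  then have xy: "Im ((x - a) * cnj (b - a)) = 0" "Im ((y - a) * cnj (b - a)) = 0"
    by (simp_all only: on_line_def mem_Collect_eq)
  have "u *\<^sub>R x + v *\<^sub>R y - a = u *\<^sub>R (x - a) + v *\<^sub>R (y - a)"
    using scaleR_add_left[of u v a] uv by (simp add: algebra_simps)
  then have "(u *\<^sub>R x + v *\<^sub>R y - a) * cnj (b - a)
      = u *\<^sub>R ((x - a) * cnj (b - a)) + v *\<^sub>R ((y - a) * cnj (b - a))"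
    by (simp only: distrib_right mult_scaleR_left)
  then have "Im ((u *\<^sub>R x + v *\<^sub>R y - a) * cnj (b - a))
      = u * Im ((x - a) * cnj (b - a)) + v * Im ((y - a) * cnj (b - a))"
    by simp
  with xy show "u *\<^sub>R x + v *\<^sub>R y \<in> {z. on_line a b z}"
    by (simp only: on_line_def mem_Collect_eq)
qed

lemma closed_segment_imp_on_line: "z \<in> closed_segment a b \<Longrightarrow> on_line a b z"
proof -
  assume "z \<in> closed_segment a b"
  moreover have "closed_segment a b \<subseteq> {z. on_line a b z}"
    by (rule closed_segment_subset[OF _ _ convex_on_line]) (simp_all add: on_line_def algebra_simps)
  ultimately show ?thesis by blast
qed

lemma on_line_imp_collinear:
  assumes "on_line a b c" shows "collinear {a, b, c}"
proof (cases "a = b")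
  case False
  define r where "r = Re ((c - a) * cnj (b - a)) / (cmod (b - a))\<^sup>2"
  have "(c - a) * cnj (b - a) = of_real (Re ((c - a) * cnj (b - a)))"
    using assms by (simp add: on_line_def complex_eq_iff)
  also have "\<dots> = of_real r * ((b - a) * cnj (b - a))"
    using False by (simp only: complex_norm_square[symmetric] of_real_mult[symmetric]) (simp add: r_def)
  finally have "c - a = of_real r * (b - a)"
    using False by (simp flip: mult.assoc)
  then have "c = a + r *\<^sub>R (b - a)" by (simp add: scaleR_conv_of_real algebra_simps)
  moreover have "a = a + 0 *\<^sub>R (b - a)" "b = a + 1 *\<^sub>R (b - a)" by simp_all
  ultimately show ?thesis unfolding collinear_alt by blast
qed auto

lemma interior_triangle_imp_not_collinear:
  fixes a b c :: complex
  assumes "z \<in> interior (convex hull {a, b, c})"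
  shows "\<not> collinear {a, b, c}"
proof
  assume "collinear {a, b, c}"
  then consider "a = b \<or> a = c \<or> b = c" | "a \<noteq> b" "a \<noteq> c" "b \<noteq> c" "affine_dependent {a, b, c}"
    by (auto simp: collinear_3_eq_affine_dependent)
  then show False
  proof cases
    case 1
    then have "interior (convex hull {a, b, c}) = {}"
      by (intro empty_interior_convex_hull)
        (auto simp: insert_commute card_insert_le_m1 insert_absorb)
    with assms show False by simp
  next
    case 2
    then show False
      using assms interior_convex_hull_eq_empty[of "{a, b, c}"] by simp
  qed
qed

text \<open>The functional that cuts out the line through \<open>a\<close> and \<open>b\<close> takes at \<open>z\<close> its value at \<open>c\<close>
multiplied by the third barycentric coordinate of \<open>z\<close>, which is positive.\<close>
lemma interior_triangle_not_on_line:
  fixes a b c :: complex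
  assumes z: "z \<in> interior (convex hull {a, b, c})"
  shows "\<not> on_line a b z"
proof
  assume line: "on_line a b z"
  have nc: "\<not> collinear {a, b, c}" using z by (rule interior_triangle_imp_not_collinear)
  then obtain t u v where tuv: "0 < v" "t + u + v = 1" "t *\<^sub>R a + u *\<^sub>R b + v *\<^sub>R c = z"
    using z interior_convex_hull_3_minimal[of a b c] by auto
  have t: "t = 1 - u - v" using tuv by simp
  have "(z - a) * cnj (b - a) = of_real u * ((b - a) * cnj (b - a)) + of_real v * ((c - a) * cnj (b - a))"
    unfolding tuv(3)[symmetric] t by (simp add: scaleR_conv_of_real algebra_simps)
  also have "(b - a) * cnj (b - a) = of_real ((cmod (b - a))\<^sup>2)"
    by (simp only: complex_norm_square)
  finally have "Im ((z - a) * cnj (b - a)) = v * Im ((c - a) * cnj (b - a))"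
    by (simp del: complex_cnj_diff of_real_power)
  with line tuv(1) have "on_line a b c" by (simp add: on_line_def)
  with on_line_imp_collinear nc show False by blast
qed

text \<open>A line is convex, so a path on it can be straightened without leaving it, even if it overshoots
its endpoints or turns back.\<close>
lemma homotopic_linepath_on_line:
  assumes "path \<delta>" "pathstart \<delta> = a" "pathfinish \<delta> = b"
    and "\<And>w. w \<in> path_image \<delta> \<Longrightarrow> on_line a b w"
    and "\<not> on_line a b z"
  shows "homotopic_paths (- {z}) \<delta> (linepath a b)"
proof (rule homotopic_paths_linear)
  fix t :: real assume t: "t \<in> {0..1}"
  have "on_line a b (\<delta> t)" using assms(4) t by (simp add: path_image_def)
  moreover have "on_line a b (linepath a b t)"
    using t by (intro closed_segment_imp_on_line) (auto simp: linepath_in_path)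
  ultimately have "closed_segment (\<delta> t) (linepath a b t) \<subseteq> {w. on_line a b w}"
    by (intro closed_segment_subset convex_on_line) auto
  with assms(5) show "closed_segment (\<delta> t) (linepath a b t) \<subseteq> - {z}" by blast
qed (use assms in auto)

lemma segment_covered_by_path_on_line:
  assumes \<delta>: "path \<delta>" "pathstart \<delta> = a" "pathfinish \<delta> = b"
    and line: "\<And>w. w \<in> path_image \<delta> \<Longrightarrow> on_line a b w"
  shows "closed_segment a b \<subseteq> path_image \<delta>"
proof
  fix z assume z: "z \<in> closed_segment a b"
  show "z \<in> path_image \<delta>"
  proof (cases "a = b")
    case True
    with z \<delta> show ?thesis by (metis closed_segment_idem pathstart_in_path_image singletonD)
  next
    case False
    define f where "f w = Re ((w - a) * cnj (b - a))" for w
    obtain u where u: "0 \<le> u" "u \<le> 1" "z = a + of_real u * (b - a)"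
      using z by (auto simp: in_segment scaleR_conv_of_real algebra_simps)
    have bb: "(b - a) * cnj (b - a) = of_real ((cmod (b - a))\<^sup>2)"
      by (simp only: complex_norm_square)
    have fz: "f z = u * (cmod (b - a))\<^sup>2"
      unfolding f_def u(3) using bb by (simp del: complex_cnj_diff of_real_power add: mult.assoc)
    have f1: "f (\<delta> 1) = (cmod (b - a))\<^sup>2"
      using \<delta>(3) bb by (simp del: complex_cnj_diff of_real_power add: f_def pathfinish_def)
    have "\<exists>t\<ge>0. t \<le> 1 \<and> f (\<delta> t) = f z"
    proof (rule IVT')
      show "f (\<delta> 0) \<le> f z" using \<delta>(2) u fz by (simp add: f_def pathstart_def)
      show "f z \<le> f (\<delta> 1)" unfolding fz f1 using u by (simp add: mult_left_le_one_le)
      show "continuous_on {0..1} (\<lambda>t. f (\<delta> t))"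
        using \<delta>(1) unfolding f_def path_def by (intro continuous_intros)
    qed simp
    then obtain t where t: "t \<in> {0..1}" "f (\<delta> t) = f z" by auto
    have "on_line a b (\<delta> t)" "on_line a b z"
      using line t(1) closed_segment_imp_on_line[OF z] by (auto simp: path_image_def)
    with t(2) have "(\<delta> t - a) * cnj (b - a) = (z - a) * cnj (b - a)"
      by (simp only: complex_eq_iff[of "(\<delta> t - a) * cnj (b - a)" "(z - a) * cnj (b - a)"]
          f_def on_line_def)
    with False have "\<delta> t = z" by simp
    with t show ?thesis by (auto simp: path_image_def)
  qed
qed

text \<open>If \<open>z\<close> were omitted, a contraction of the loop in \<open>V\<close> would be carried by \<open>g\<close> to a contraction in
the plane punctured at \<open>z\<close>, whereas the image loop is homotopic there to the boundary of a triangle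
around \<open>z\<close>.\<close>
lemma triangle_covered_by_simply_connected_image:
  fixes g :: "'a::real_normed_vector \<Rightarrow> complex"
  assumes V: "simply_connected V" and g: "continuous_on V g"
    and \<gamma>1: "path \<gamma>1" "path_image \<gamma>1 \<subseteq> V" "pathstart \<gamma>1 = u" "pathfinish \<gamma>1 = v"
    and \<gamma>2: "path \<gamma>2" "path_image \<gamma>2 \<subseteq> V" "pathstart \<gamma>2 = v" "pathfinish \<gamma>2 = w"
    and \<gamma>3: "path \<gamma>3" "path_image \<gamma>3 \<subseteq> V" "pathstart \<gamma>3 = w" "pathfinish \<gamma>3 = u"
    and line1: "\<And>x. x \<in> path_image \<gamma>1 \<Longrightarrow> on_line (g u) (g v) (g x)"
    and line2: "\<And>x. x \<in> path_image \<gamma>2 \<Longrightarrow> on_line (g v) (g w) (g x)"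
    and line3: "\<And>x. x \<in> path_image \<gamma>3 \<Longrightarrow> on_line (g w) (g u) (g x)"
    and z: "z \<in> interior (convex hull {g u, g v, g w})"
  shows "z \<in> g ` V"
proof (rule ccontr)
  assume notin: "z \<notin> g ` V"
  define \<Gamma> where "\<Gamma> = \<gamma>1 +++ (\<gamma>2 +++ \<gamma>3)"
  have \<Gamma>: "path \<Gamma>" "path_image \<Gamma> \<subseteq> V" "pathfinish \<Gamma> = pathstart \<Gamma>" "pathstart \<Gamma> = u"
    using \<gamma>1 \<gamma>2 \<gamma>3 by (auto simp: \<Gamma>_def path_image_join)
  have "homotopic_paths V \<Gamma> (linepath u u)"
    using V \<Gamma> unfolding simply_connected_eq_contractible_path by metis
  then have "homotopic_paths (- {z}) (g \<circ> \<Gamma>) (g \<circ> linepath u u)"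
    by (rule homotopic_paths_continuous_image[OF _ g]) (use notin in auto)
  then have "winding_number (g \<circ> \<Gamma>) z = winding_number (g \<circ> linepath u u) z"
    by (rule winding_number_homotopic_paths)
  also have "g \<circ> linepath u u = (\<lambda>t. g u)" by (auto simp: linepath_def algebra_simps)
  also have "winding_number (\<lambda>t. g u) z = 0"
    using notin \<gamma>1 by (intro winding_number_zero_const) auto
  finally have zero: "winding_number (g \<circ> \<Gamma>) z = 0" .
  have hull: "{g v, g w, g u} = {g u, g v, g w}" "{g w, g u, g v} = {g u, g v, g w}" by auto
  have hom: "homotopic_paths (- {z}) (g \<circ> \<gamma>) (linepath (g a) (g b))"
    if "path \<gamma>" "path_image \<gamma> \<subseteq> V" "pathstart \<gamma> = a" "pathfinish \<gamma> = b"
      "\<And>x. x \<in> path_image \<gamma> \<Longrightarrow> on_line (g a) (g b) (g x)"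
      "\<not> on_line (g a) (g b) z" for \<gamma> a b
    using that by (intro homotopic_linepath_on_line path_continuous_image continuous_on_subset[OF g])
      (auto simp: pathstart_compose pathfinish_compose path_image_compose)
  have "homotopic_paths (- {z}) (g \<circ> \<gamma>1) (linepath (g u) (g v))"
    using \<gamma>1 line1 interior_triangle_not_on_line[OF z] by (intro hom)
  moreover have "homotopic_paths (- {z}) (g \<circ> \<gamma>2) (linepath (g v) (g w))"
    using \<gamma>2 line2 z hull interior_triangle_not_on_line[of z "g v" "g w" "g u"] by (intro hom) simp_all
  moreover have "homotopic_paths (- {z}) (g \<circ> \<gamma>3) (linepath (g w) (g u))"
    using \<gamma>3 line3 z hull interior_triangle_not_on_line[of z "g w" "g u" "g v"] by (intro hom) simp_all
  ultimately have "homotopic_paths (- {z}) (g \<circ> \<Gamma>)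
      (linepath (g u) (g v) +++ linepath (g v) (g w) +++ linepath (g w) (g u))"
    unfolding \<Gamma>_def path_compose_join using \<gamma>1 \<gamma>2 \<gamma>3
    by (intro homotopic_paths_join) (auto simp: pathstart_compose pathfinish_compose)
  from winding_number_homotopic_paths[OF this] zero winding_number_triangle[OF z]
  show False by (simp split: if_splits)
qed

text \<open>Caratheodory's theorem in the plane gives a triangle, possibly degenerate; its frontier consists of
its three sides, so nothing but sides and interior can occur.\<close>
lemma complex_convex_hull_triangle_cases:
  fixes z :: complex
  assumes "z \<in> convex hull S"
  obtains a b where "a \<in> S" "b \<in> S" "z \<in> closed_segment a b"
  | a b c where "a \<in> S" "b \<in> S" "c \<in> S" "z \<in> interior (convex hull {a, b, c})"
proof -
  obtain F where F: "finite F" "F \<subseteq> S" "card F \<le> 3" "z \<in> convex hull F"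
    using assms unfolding caratheodory[of S] by auto
  then have "F \<noteq> {}" by auto
  then have "card F \<noteq> 0" using F by simp
  with F(3) have "card F = 1 \<or> card F = 2 \<or> card F = 3" by linarith
  then obtain a b c where abc: "F = {a, b, c}"
    by (metis card_1_singletonE card_2_iff card_3_iff insert_absorb2)
  have "z \<in> closure (convex hull {a, b, c})" using F abc closure_subset by blast
  then have "z \<in> interior (convex hull {a, b, c}) \<union> frontier (convex hull {a, b, c})"
    by (auto simp: frontier_def)
  then show thesis
    using that F(2) abc by (auto simp: frontier_of_triangle)
qed

section \<open>The homogeneous quotient on nonzero vectors\<close>

text \<open>Dividing by the \<open>p\<close>-th power of the \<open>p\<close>-norm extends the form from the unit sphere to all nonzero
vectors, so that paths need not be normalised and the domain is a punctured space.\<close>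
definition rayleigh :: "real \<Rightarrow> (complex ^ 'n \<Rightarrow> complex ^ 'n) \<Rightarrow> complex ^ 'n \<Rightarrow> complex" where
  "rayleigh p T x = pairing (T x) (duality_map p x) / of_real (\<Sum>j\<in>UNIV. cmod (x $ j) powr p)"

text \<open>One coordinate of the duality map. The value at \<open>0\<close> is \<open>0\<close> because of the first factor, whatever
the sign of \<open>p - 2\<close>.\<close>
definition scalar_duality :: "real \<Rightarrow> complex \<Rightarrow> complex" where
  "scalar_duality p z = z * of_real (cmod z powr (p - 2))"

lemma duality_map_nth: "duality_map p x $ j = scalar_duality p (x $ j)"
  by (simp add: duality_map_def scalar_duality_def)

lemma scalar_duality_0 [simp]: "scalar_duality p 0 = 0"
  by (simp add: scalar_duality_def)

lemma norm_scalar_duality: "cmod (scalar_duality p z) = cmod z powr (p - 1)"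
  by (cases "z = 0") (simp_all add: scalar_duality_def norm_mult powr_mult_base)

lemma mult_cnj_scalar_duality: "z * cnj (scalar_duality p z) = of_real (cmod z powr p)"
proof (cases "z = 0")
  case False
  have "z * cnj (scalar_duality p z) = (z * cnj z) * of_real (cmod z powr (p - 2))"
    by (simp add: scalar_duality_def)
  also have "\<dots> = of_real ((cmod z)\<^sup>2 * cmod z powr (p - 2))"
    by (simp only: complex_norm_square of_real_mult)
  also have "(cmod z)\<^sup>2 * cmod z powr (p - 2) = cmod z powr p"
    using False powr_add[of "cmod z" 2 "p - 2"] by simp
  finally show ?thesis .
qed simp

lemma scalar_duality_scale:
  assumes "0 \<le> r"
  shows "scalar_duality p (of_real r * z) = of_real (r powr (p - 1)) * scalar_duality p z"
proof (cases "r = 0")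
  case False
  then have "r * r powr (p - 2) = r powr (p - 1)"
    using assms powr_mult_base[of r "p - 2"] by simp
  then show ?thesis
    using assms by (simp add: scalar_duality_def norm_mult powr_mult flip: of_real_mult)
qed simp

text \<open>At the origin the factor with exponent \<open>p - 2\<close> may blow up, but the modulus of the product is
\<open>\<bar>z\<bar>\<close> to the power \<open>p - 1 > 0\<close>.\<close>
lemma continuous_scalar_duality:
  assumes "1 < p"
  shows "continuous_on UNIV (scalar_duality p)"
proof (intro continuous_at_imp_continuous_on ballI)
  fix z :: complex
  show "isCont (scalar_duality p) z"
  proof (cases "z = 0")
    case True
    have "((\<lambda>w::complex. cmod w powr (p - 1)) \<longlongrightarrow> 0 powr (p - 1)) (at 0)"
      using assms by (intro tendsto_powr' tendsto_norm_zero tendsto_const tendsto_ident_at) auto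
    then show ?thesis
      using True by (simp add: isCont_def tendsto_norm_zero_iff[of "scalar_duality p", symmetric]
        norm_scalar_duality)
  next
    case False
    then show ?thesis unfolding scalar_duality_def[abs_def]
      by (intro continuous_intros) auto
  qed
qed

lemma sum_cmod_powr_pos:
  fixes x :: "complex ^ 'n"
  assumes "x \<noteq> 0"
  shows "0 < (\<Sum>j\<in>UNIV. cmod (x $ j) powr p)"
proof -
  obtain i where "x $ i \<noteq> 0" using assms by (auto simp: vec_eq_iff)
  then have "0 < cmod (x $ i) powr p" by simp
  then show ?thesis by (intro sum_pos2[of _ i]) auto
qed

lemma continuous_rayleigh:
  fixes T :: "complex ^ 'n \<Rightarrow> complex ^ 'n"
  assumes p: "1 < p" and T: "Vector_Spaces.linear (*s) (*s) T"
  shows "continuous_on (- {0}) (rayleigh p T)"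
proof -
  have T': "T x $ i = (\<Sum>k\<in>UNIV. matrix T $ i $ k * x $ k)" for x i
    by (simp flip: matrix_works[OF T] add: matrix_vector_mult_def)
  have J: "continuous_on (- {0}) (\<lambda>x::complex ^ 'n. scalar_duality p (x $ i))" for i
    by (rule continuous_on_compose2[OF continuous_scalar_duality[OF p]]) (intro continuous_intros, simp)
  have "(\<Sum>j\<in>UNIV. cmod (x $ j) powr p) \<noteq> 0" if "x \<in> - {0}" for x :: "complex ^ 'n"
    using sum_cmod_powr_pos[of x p] that by auto
  then show ?thesis
    unfolding rayleigh_def pairing_def duality_map_nth T'
    using p by (intro continuous_intros continuous_on_powr' J) (auto simp flip: of_real_sum)
qed

lemma rayleigh_in_numerical_range:
  fixes x :: "complex ^ 'n"
  assumes p: "1 < p" and T: "Vector_Spaces.linear (*s) (*s) T" and x: "x \<noteq> 0"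
  shows "rayleigh p T x \<in> numerical_range p T"
proof -
  define N where "N = (\<Sum>j\<in>UNIV. cmod (x $ j) powr p)"
  have N: "0 < N" unfolding N_def by (rule sum_cmod_powr_pos[OF x])
  define r where "r = N powr (- 1 / p)"
  have r: "0 < r" using N by (simp add: r_def)
  have rp: "r powr p = 1 / N"
    unfolding r_def powr_powr using N p by (simp add: powr_minus_divide)
  define y where "y = of_real r *s x"
  have "(\<Sum>j\<in>UNIV. cmod (y $ j) powr p) = r powr p * N"
    using r by (simp add: y_def N_def norm_mult powr_mult sum_distrib_left)
  then have y: "lp_norm p y = 1" using N rp by (simp add: lp_norm_def)
  have "T y = of_real r *s T x" unfolding y_def
    using T by (simp add: Vector_Spaces.linear_iff)
  then have "pairing (T y) (duality_map p y)
      = of_real (r * r powr (p - 1)) * pairing (T x) (duality_map p x)"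
    using r by (simp add: pairing_def duality_map_nth y_def scalar_duality_scale sum_distrib_left mult_ac)
  also have "r * r powr (p - 1) = 1 / N" using r rp by (simp add: powr_mult_base)
  finally have "pairing (T y) (duality_map p y) = rayleigh p T x"
    by (simp add: rayleigh_def N_def)
  with y show ?thesis unfolding numerical_range_def by (metis (mono_tags, lifting) mem_Collect_eq)
qed

lemma pairing_axis: "pairing y (axis j c) = y $ j * cnj c"
  by (simp add: pairing_def axis_def if_distrib cong: if_cong)

lemma pairing_add_right: "pairing y (u + v) = pairing y u + pairing y v"
  by (simp add: pairing_def distrib_left sum.distrib)

lemma linear_axis:
  fixes T :: "complex ^ 'n \<Rightarrow> complex ^ 'n"
  assumes "Vector_Spaces.linear (*s) (*s) T"
  shows "T (axis j c) = c *s T (axis j 1)"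
proof -
  have "axis j c = c *s axis j (1::complex)" by (simp add: vec_eq_iff axis_def)
  then show ?thesis using assms by (simp add: Vector_Spaces.linear_iff)
qed

lemma rayleigh_axis:
  assumes T: "Vector_Spaces.linear (*s) (*s) T" and c: "c \<noteq> 0"
  shows "rayleigh p T (axis j c) = T (axis j 1) $ j"
proof -
  have J: "duality_map p (axis j c) = axis j (scalar_duality p c)"
    by (simp add: vec_eq_iff duality_map_nth axis_def)
  have N: "(\<Sum>i\<in>UNIV. cmod (axis j c $ i) powr p) = cmod c powr p"
    by (simp add: axis_def if_distrib if_distribR cong: if_cong)
  have "pairing (T (axis j c)) (duality_map p (axis j c))
      = T (axis j 1) $ j * (c * cnj (scalar_duality p c))"
    by (simp add: J pairing_axis linear_axis[OF T, of j c])
  then show ?thesis using c by (simp add: rayleigh_def N mult_cnj_scalar_duality)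
qed

text \<open>The weighted mean of the two diagonal entries is perturbed by the two off-diagonal entries, which
carry opposite phases \<open>w\<close> and \<open>cnj w\<close> and, for \<open>p \<noteq> 2\<close>, differently varying weights.\<close>
lemma rayleigh_two_axes:
  assumes T: "Vector_Spaces.linear (*s) (*s) T" and jk: "j \<noteq> k"
    and ab: "0 \<le> a" "0 \<le> b" and w: "cmod w = 1"
  shows "rayleigh p T (axis j (of_real a) + axis k (of_real b * w)) =
    (of_real (a powr p) * T (axis j 1) $ j + of_real (b powr p) * T (axis k 1) $ k
      + of_real (b * a powr (p - 1)) * (T (axis k 1) $ j * w)
      + of_real (a * b powr (p - 1)) * (T (axis j 1) $ k * cnj w)) / of_real (a powr p + b powr p)"
proof -
  let ?x = "axis j (of_real a) + axis k (of_real b * w) :: complex ^ 'a"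
  have w1: "scalar_duality p w = w" using w by (simp add: scalar_duality_def)
  have sa: "scalar_duality p (of_real a) = of_real (a powr (p - 1))"
    using scalar_duality_scale[OF ab(1), of p 1] by (simp add: scalar_duality_def)
  have sb: "scalar_duality p (of_real b * w) = of_real (b powr (p - 1)) * w"
    using scalar_duality_scale[OF ab(2), of p w] w1 by simp
  have J: "duality_map p ?x = axis j (of_real (a powr (p - 1))) + axis k (of_real (b powr (p - 1)) * w)"
    using jk by (auto simp: vec_eq_iff duality_map_nth axis_def sa sb)
  have "(\<Sum>i\<in>UNIV. cmod (?x $ i) powr p)
      = (\<Sum>i\<in>UNIV. (if i = j then a powr p else 0) + (if i = k then b powr p else 0))"
    using jk ab w by (intro sum.cong) (auto simp: axis_def norm_mult)
  then have N: "(\<Sum>i\<in>UNIV. cmod (?x $ i) powr p) = a powr p + b powr p"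
    by (simp add: sum.distrib)
  have Tx: "T ?x = of_real a *s T (axis j 1) + (of_real b * w) *s T (axis k 1)"
    using T by (simp add: Vector_Spaces.linear_iff linear_axis[OF T, of j "of_real a"]
      linear_axis[OF T, of k "of_real b * w"])
  have pw: "a * a powr (p - 1) = a powr p" "b * b powr (p - 1) = b powr p"
    using ab powr_mult_base[of a "p - 1"] powr_mult_base[of b "p - 1"] by simp_all
  have ww: "w * cnj w = 1" using w complex_norm_square[of w] by simp
  have "pairing (T ?x) (duality_map p ?x) =
      of_real (a * a powr (p - 1)) * T (axis j 1) $ j
      + of_real (b * b powr (p - 1)) * (w * cnj w) * T (axis k 1) $ k
      + of_real (b * a powr (p - 1)) * (T (axis k 1) $ j * w)
      + of_real (a * b powr (p - 1)) * (T (axis j 1) $ k * cnj w)"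
    unfolding J pairing_add_right pairing_axis Tx by (simp add: algebra_simps)
  then show ?thesis unfolding rayleigh_def N pw ww by simp
qed

section \<open>Paths between coordinate vectors\<close>

text \<open>With \<open>a = 1 - s\<close> and \<open>b = s\<close>, the weights of the two off-diagonal entries both vanish at
\<open>s = 0\<close> and \<open>s = 1\<close>. Their common zeros must be divided out for the ratio of the weights
to have a limit at the ends; what is left has no common zero, so that this ratio is a point of the
projective line depending continuously on \<open>s\<close>. The order of the common zeros is \<open>p - 1\<close> for \<open>p < 2\<close>
and \<open>1\<close> for \<open>p \<ge> 2\<close>. The case \<open>p = 2\<close> is kept apart because \<open>0 powr 0 = 0\<close>.\<close>
lemma weights_factorization:
  fixes p :: real
  assumes "1 < p"
  obtains u v c :: "real \<Rightarrow> real"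
  where "continuous_on {0..1} u" "continuous_on {0..1} v"
    and "\<And>s. s \<in> {0..1} \<Longrightarrow> u s \<noteq> 0 \<or> v s \<noteq> 0"
    and "\<And>s. s \<in> {0..1} \<Longrightarrow> s * (1 - s) powr (p - 1) = c s * u s"
    and "\<And>s. s \<in> {0..1} \<Longrightarrow> (1 - s) * s powr (p - 1) = c s * v s"
proof -
  consider "p < 2" | "p = 2" | "2 < p" by linarith
  then show thesis
  proof cases
    case 1
    have split: "r = r powr (p - 1) * r powr (2 - p)" if "0 \<le> r" for r :: real
      using that by (cases "r = 0") (simp_all flip: powr_add)
    show thesis
    proof (rule that[of "\<lambda>s. s powr (2 - p)" "\<lambda>s. (1 - s) powr (2 - p)"
          "\<lambda>s. s powr (p - 1) * (1 - s) powr (p - 1)"])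
      show "s * (1 - s) powr (p - 1) = s powr (p - 1) * (1 - s) powr (p - 1) * s powr (2 - p)"
        if "s \<in> {0..1}" for s using split[of s] that by simp
      show "(1 - s) * s powr (p - 1) = s powr (p - 1) * (1 - s) powr (p - 1) * (1 - s) powr (2 - p)"
        if "s \<in> {0..1}" for s using split[of "1 - s"] that by simp
    qed (use 1 in \<open>auto intro!: continuous_on_powr' continuous_on_diff continuous_on_const continuous_on_id\<close>)
  next
    case 2
    show thesis
      by (rule that[of "\<lambda>_. 1" "\<lambda>_. 1" "\<lambda>s. s * (1 - s)"]) (use 2 in \<open>auto\<close>)
  next
    case 3
    have split: "r powr (p - 1) = r * r powr (p - 2)" if "0 \<le> r" for r :: real
      using that powr_mult_base[of r "p - 2"] by simp
    show thesis
    proof (rule that[of "\<lambda>s. (1 - s) powr (p - 2)" "\<lambda>s. s powr (p - 2)" "\<lambda>s. s * (1 - s)"])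
    qed (use 3 split in \<open>auto intro!: continuous_on_powr' continuous_on_diff continuous_on_const continuous_on_id\<close>)
  qed
qed

text \<open>Since \<open>Im (\<beta> * cnj w) = - Im (cnj \<beta> * w)\<close>, the condition at \<open>s\<close> says that \<open>C s * w\<close> is real for
\<open>C s = u s * \<alpha> - v s * cnj \<beta>\<close>, up to the common factor of the weights. If \<open>C\<close> has no zero, the phase
conjugate to that of \<open>C s\<close> is continuous. If \<open>C\<close> has a zero, then \<open>\<alpha>\<close> and \<open>cnj \<beta>\<close> are real
multiples of one complex number, and a constant phase makes both products real for every \<open>s\<close>.\<close>
lemma exists_phase:
  fixes \<alpha> \<beta> :: complex
  assumes "1 < p"
  obtains w :: "real \<Rightarrow> complex"
  where "continuous_on {0..1} w" "\<And>s. s \<in> {0..1} \<Longrightarrow> cmod (w s) = 1"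
    and "\<And>s. s \<in> {0..1} \<Longrightarrow> Im (of_real (s * (1 - s) powr (p - 1)) * (\<alpha> * w s)
        + of_real ((1 - s) * s powr (p - 1)) * (\<beta> * cnj (w s))) = 0"
proof -
  obtain u v c :: "real \<Rightarrow> real"
    where uv: "continuous_on {0..1} u" "continuous_on {0..1} v"
      and nz: "\<And>s. s \<in> {0..1} \<Longrightarrow> u s \<noteq> 0 \<or> v s \<noteq> 0"
      and P: "\<And>s. s \<in> {0..1} \<Longrightarrow> s * (1 - s) powr (p - 1) = c s * u s"
      and Q: "\<And>s. s \<in> {0..1} \<Longrightarrow> (1 - s) * s powr (p - 1) = c s * v s"
    using weights_factorization[OF assms] by metis
  define C where "C s = of_real (u s) * \<alpha> - of_real (v s) * cnj \<beta>" for s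
  have Im_C: "Im (of_real (s * (1 - s) powr (p - 1)) * (\<alpha> * w)
      + of_real ((1 - s) * s powr (p - 1)) * (\<beta> * cnj w)) = c s * Im (C s * w)"
    if "s \<in> {0..1}" for s w
    unfolding P[OF that] Q[OF that] C_def by (simp add: algebra_simps)
  have unit: "cmod (cnj (sgn z)) = 1" "Im (z * cnj (sgn z)) = 0" if "z \<noteq> 0" for z
    using that by (simp only: complex_mod_cnj norm_sgn if_False, simp add: sgn_eq algebra_simps)
  show thesis
  proof (cases "\<exists>s\<in>{0..1}. C s = 0")
    case False
    show thesis
    proof (rule that[of "\<lambda>s. cnj (sgn (C s))"])
      show "continuous_on {0..1} (\<lambda>s. cnj (sgn (C s)))"
        using False uv unfolding C_def by (intro continuous_intros) auto
    qed (use False in \<open>simp_all only: Im_C unit bex_simps mult_zero_right not_False_eq_True ball_simps\<close>)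
  next
    case True
    then obtain t where t: "t \<in> {0..1}" "of_real (u t) * \<alpha> = of_real (v t) * cnj \<beta>"
      by (auto simp: C_def)
    \<comment> \<open>One of the real coefficients \<open>u t\<close>, \<open>v t\<close> is nonzero, so the relation at \<open>t\<close> is a real linear dependence.\<close>
    have "\<exists>w. cmod w = 1 \<and> Im (\<alpha> * w) = 0 \<and> Im (cnj \<beta> * w) = 0"
    proof -
      obtain z x y where xy: "\<alpha> = of_real x * z" "cnj \<beta> = of_real y * z"
      proof (cases "u t = 0")
        case True
        with t nz[OF t(1)] have "cnj \<beta> = 0" by auto
        then show thesis using that[of 1 \<alpha> 0] by simp
      next
        case False
        then have "\<alpha> = of_real (v t / u t) * cnj \<beta>" using t(2) by (simp add: field_simps)
        then show thesis using that[of "v t / u t" "cnj \<beta>" 1] by simp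
      qed
      show ?thesis
      proof (cases "z = 0")
        case True
        then show ?thesis using xy by (intro exI[of _ 1]) simp
      next
        case False
        then show ?thesis unfolding xy mult.assoc
          using unit[OF False] by (intro exI[of _ "cnj (sgn z)"]) simp
      qed
    qed
    then obtain w where w: "cmod w = 1" "Im (\<alpha> * w) = 0" "Im (cnj \<beta> * w) = 0" by blast
    have "Im (C s * w) = 0" for s
      using w(2,3) by (simp add: C_def left_diff_distrib mult.assoc)
    then show thesis using that[of "\<lambda>_. w"] w(1) Im_C by simp
  qed
qed

lemma continuous_on_axis:
  fixes f :: "'a::topological_space \<Rightarrow> complex"
  assumes "continuous_on S f"
  shows "continuous_on S (\<lambda>s. axis j (f s) :: complex ^ 'n)"
  unfolding axis_def
proof (intro continuous_on_vec_lambda)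
  show "continuous_on S (\<lambda>s. if i = j then f s else 0)" for i
    using assms by (cases "i = j") simp_all
qed

text \<open>The phases come from the off-diagonal entries rotated by \<open>cnj (B - A)\<close>, which turns the direction of
the line into the real axis. The path with these phases ends at a multiple of \<open>e\<^sub>k\<close>; a rotation in
the \<open>k\<close>-th coordinate, under which the quotient is constant, leads from there to \<open>e\<^sub>k\<close> itself.\<close>
lemma axis_edge_path:
  fixes T :: "complex ^ 'n \<Rightarrow> complex ^ 'n"
  assumes p: "1 < p" and T: "Vector_Spaces.linear (*s) (*s) T" and jk: "j \<noteq> k"
  obtains \<gamma> where "path \<gamma>" "path_image \<gamma> \<subseteq> - {0}" "pathstart \<gamma> = axis j 1" "pathfinish \<gamma> = axis k 1"
    and "\<And>x. x \<in> path_image \<gamma> \<Longrightarrow>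
      on_line (rayleigh p T (axis j 1)) (rayleigh p T (axis k 1)) (rayleigh p T x)"
proof -
  define A B where "A = T (axis j 1) $ j" and "B = T (axis k 1) $ k"
  have AB: "rayleigh p T (axis j 1) = A" "rayleigh p T (axis k 1) = B"
    using rayleigh_axis[OF T, of 1 p] by (simp_all add: A_def B_def)
  define \<alpha> \<beta> where "\<alpha> = cnj (B - A) * T (axis k 1) $ j" and "\<beta> = cnj (B - A) * T (axis j 1) $ k"
  obtain w :: "real \<Rightarrow> complex"
    where w: "continuous_on {0..1} w" "\<And>s. s \<in> {0..1} \<Longrightarrow> cmod (w s) = 1"
      and im: "\<And>s. s \<in> {0..1} \<Longrightarrow> Im (of_real (s * (1 - s) powr (p - 1)) * (\<alpha> * w s)
        + of_real ((1 - s) * s powr (p - 1)) * (\<beta> * cnj (w s))) = 0"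
    using exists_phase[OF p, of \<alpha> \<beta>] by metis
  define \<gamma>1 :: "real \<Rightarrow> complex ^ 'n"
    where "\<gamma>1 s = axis j (of_real (1 - s)) + axis k (of_real s * w s)" for s
  have w1: "w 1 \<noteq> 0" using w(2)[of 1] by auto
  have "path_connected (- {0::complex})" by (rule path_connected_punctured_universe) simp
  then obtain \<delta> where \<delta>: "path \<delta>" "path_image \<delta> \<subseteq> - {0}" "pathstart \<delta> = w 1" "pathfinish \<delta> = 1"
    unfolding path_connected_def using w1 by (metis ComplI singletonD zero_neq_one)
  define \<gamma>2 :: "real \<Rightarrow> complex ^ 'n" where "\<gamma>2 s = axis k (\<delta> s)" for s
  have path: "path \<gamma>1" "path \<gamma>2"
    unfolding path_def \<gamma>1_def \<gamma>2_def using w(1) \<delta>(1)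
    by (auto intro!: continuous_intros continuous_on_axis simp: path_def)
  have ends: "pathstart \<gamma>1 = axis j 1" "pathfinish \<gamma>1 = axis k (w 1)"
      "pathstart \<gamma>2 = axis k (w 1)" "pathfinish \<gamma>2 = axis k 1"
    using \<delta>(3,4) by (simp_all add: \<gamma>1_def \<gamma>2_def pathstart_def pathfinish_def vec_eq_iff axis_def)
  have nz1: "\<gamma>1 s \<noteq> 0" if "s \<in> {0..1}" for s
  proof
    assume "\<gamma>1 s = 0"
    then have "\<gamma>1 s $ j = 0" "\<gamma>1 s $ k = 0" by simp_all
    with jk have "s = 1" "of_real s * w s = 0" by (simp_all add: \<gamma>1_def axis_def)
    with w1 show False by simp
  qed
  have line1: "on_line A B (rayleigh p T (\<gamma>1 s))" if s: "s \<in> {0..1}" for s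
  proof -
    define N where "N = (1 - s) powr p + s powr p"
    have N: "0 < N" using s by (cases "s = 0") (auto simp: N_def intro: add_nonneg_pos)
    define X where "X = of_real (s * (1 - s) powr (p - 1)) * (T (axis k 1) $ j * w s)
      + of_real ((1 - s) * s powr (p - 1)) * (T (axis j 1) $ k * cnj (w s))"
    have "rayleigh p T (\<gamma>1 s)
        = (of_real ((1 - s) powr p) * A + of_real (s powr p) * B + X) / of_real N"
      unfolding \<gamma>1_def X_def A_def B_def N_def using s
      by (subst rayleigh_two_axes[OF T jk]) (simp_all add: w(2))
    then have "rayleigh p T (\<gamma>1 s) - A
        = (of_real ((1 - s) powr p) * A + of_real (s powr p) * B + X - of_real N * A) / of_real N"
      using N by (simp add: diff_divide_distrib)
    also have "of_real ((1 - s) powr p) * A + of_real (s powr p) * B + X - of_real N * A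
        = of_real (s powr p) * (B - A) + X"
      by (simp add: N_def algebra_simps)
    finally have "(rayleigh p T (\<gamma>1 s) - A) * cnj (B - A)
        = (of_real (s powr p) * ((B - A) * cnj (B - A)) + cnj (B - A) * X) / of_real N"
      by (simp only: times_divide_eq_left distrib_right mult.assoc mult.commute[of X])
    also have "(B - A) * cnj (B - A) = of_real ((cmod (B - A))\<^sup>2)"
      by (simp only: complex_norm_square)
    finally have "Im ((rayleigh p T (\<gamma>1 s) - A) * cnj (B - A)) = Im (cnj (B - A) * X) / N"
      by (simp del: complex_cnj_diff of_real_power)
    also have "cnj (B - A) * X = of_real (s * (1 - s) powr (p - 1)) * (\<alpha> * w s)
        + of_real ((1 - s) * s powr (p - 1)) * (\<beta> * cnj (w s))"
      by (simp add: X_def \<alpha>_def \<beta>_def distrib_left mult_ac)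
    finally show ?thesis unfolding on_line_def im[OF s] by simp
  qed
  have nz2: "\<delta> s \<noteq> 0" if "s \<in> {0..1}" for s using \<delta>(2) that by (auto simp: path_image_def)
  have line2: "on_line A B (rayleigh p T (\<gamma>2 s))" if "s \<in> {0..1}" for s
    unfolding \<gamma>2_def rayleigh_axis[OF T nz2[OF that]] B_def[symmetric]
    by (rule closed_segment_imp_on_line) simp
  have image: "path_image (\<gamma>1 +++ \<gamma>2) = \<gamma>1 ` {0..1} \<union> \<gamma>2 ` {0..1}"
    using path_image_join[of \<gamma>1 \<gamma>2] by (simp add: ends path_image_def[of \<gamma>1] path_image_def[of \<gamma>2])
  show thesis
  proof (rule that[of "\<gamma>1 +++ \<gamma>2"])
    show "path_image (\<gamma>1 +++ \<gamma>2) \<subseteq> - {0}"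
      unfolding image using nz1 nz2 by (auto simp: \<gamma>2_def axis_eq_0_iff)
    show "on_line (rayleigh p T (axis j 1)) (rayleigh p T (axis k 1)) (rayleigh p T x)"
      if "x \<in> path_image (\<gamma>1 +++ \<gamma>2)" for x
      using that line1 line2 unfolding AB image by blast
  qed (use path ends in simp_all)
qed

section \<open>The convex hull of the diagonal\<close>
theorem theorem2p7:
  fixes p :: real and T :: "complex ^ 'n \<Rightarrow> complex ^ 'n"
  assumes "1 < p"
    and "Vector_Spaces.linear (*s) (*s) T"
  shows "convex hull {pairing (T (axis j 1)) (duality_map p (axis j 1)) | j. j \<in> UNIV}
           \<subseteq> numerical_range p T"
proof
  let ?g = "rayleigh p T"
  let ?D = "range (\<lambda>j. ?g (axis j 1))"
  fix z
  assume "z \<in> convex hull {pairing (T (axis j 1)) (duality_map p (axis j 1)) | j. j \<in> UNIV}"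
  moreover have "pairing (T (axis j 1)) (duality_map p (axis j 1)) = ?g (axis j 1)" for j
    unfolding rayleigh_def by (simp add: axis_def if_distrib if_distribR cong: if_cong)
  ultimately have "z \<in> convex hull ?D" by (simp add: full_SetCompr_eq)
  then have "z \<in> ?g ` (- {0})"
  proof (cases rule: complex_convex_hull_triangle_cases)
    case (1 a b)
    then obtain j k where jk: "a = ?g (axis j 1)" "b = ?g (axis k 1)" by blast
    show ?thesis
    proof (cases "j = k")
      case True
      with 1 jk have "z = ?g (axis j 1)" by simp
      then show ?thesis by (auto simp: axis_eq_0_iff)
    next
      case False
      obtain \<gamma> where \<gamma>: "path \<gamma>" "path_image \<gamma> \<subseteq> - {0}" "pathstart \<gamma> = axis j 1" "pathfinish \<gamma> = axis k 1"
        and line: "\<And>x. x \<in> path_image \<gamma> \<Longrightarrow> on_line a b (?g x)"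
        using axis_edge_path[OF assms False] unfolding jk by metis
      have "closed_segment a b \<subseteq> path_image (?g \<circ> \<gamma>)"
        using \<gamma> line
        by (intro segment_covered_by_path_on_line path_continuous_image
            continuous_on_subset[OF continuous_rayleigh[OF assms]])
          (auto simp: pathstart_compose pathfinish_compose path_image_compose jk)
      with 1 \<gamma>(2) show ?thesis by (auto simp: path_image_compose)
    qed
  next
    case (2 a b c)
    then obtain i j k where ijk: "a = ?g (axis i 1)" "b = ?g (axis j 1)" "c = ?g (axis k 1)" by blast
    have "\<not> collinear {a, b, c}" using 2 by (intro interior_triangle_imp_not_collinear)
    then have ne: "i \<noteq> j" "j \<noteq> k" "k \<noteq> i" unfolding ijk by (auto simp: insert_commute)
    then have "card {i, j, k} = 3" by simp
    then have "3 \<le> CARD('n)" by (metis card_mono finite subset_UNIV)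
    then have V: "simply_connected (- {0 :: complex ^ 'n})"
      by (intro simply_connected_punctured_universe) simp
    obtain \<gamma>1 where \<gamma>1: "path \<gamma>1" "path_image \<gamma>1 \<subseteq> - {0}" "pathstart \<gamma>1 = axis i 1" "pathfinish \<gamma>1 = axis j 1"
        and line1: "\<And>x. x \<in> path_image \<gamma>1 \<Longrightarrow> on_line a b (?g x)"
      using axis_edge_path[OF assms ne(1)] unfolding ijk by metis
    obtain \<gamma>2 where \<gamma>2: "path \<gamma>2" "path_image \<gamma>2 \<subseteq> - {0}" "pathstart \<gamma>2 = axis j 1" "pathfinish \<gamma>2 = axis k 1"
        and line2: "\<And>x. x \<in> path_image \<gamma>2 \<Longrightarrow> on_line b c (?g x)"
      using axis_edge_path[OF assms ne(2)] unfolding ijk by metis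
    obtain \<gamma>3 where \<gamma>3: "path \<gamma>3" "path_image \<gamma>3 \<subseteq> - {0}" "pathstart \<gamma>3 = axis k 1" "pathfinish \<gamma>3 = axis i 1"
        and line3: "\<And>x. x \<in> path_image \<gamma>3 \<Longrightarrow> on_line c a (?g x)"
      using axis_edge_path[OF assms ne(3)] unfolding ijk by metis
    show ?thesis
      using triangle_covered_by_simply_connected_image[OF V continuous_rayleigh[OF assms]
          \<gamma>1 \<gamma>2 \<gamma>3 line1[unfolded ijk] line2[unfolded ijk] line3[unfolded ijk]]
        2(4) unfolding ijk by blast
  qed
  then show "z \<in> numerical_range p T"
    using rayleigh_in_numerical_range[OF assms] by blast
qed

end
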